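(* Let $\Gamma$ be a finite mixed graph with vertex set $V$ and underlying simplicial graph $\overline{\Gamma}$. Then the Cayley graph of the twisted right-angled Artin group $G_\Gamma$ and the Cayley graph of its underlying right-angled Artin group $G_{\overline{\Gamma}}$, both with respect to the generating set $S=V\sqcup V^{-1}$, are isomorphic as undirected (unlabelled) graphs.
   Context: A mixed graph $\Gamma$ consists of a finite vertex set $V$, a set $E$ of two-element subsets of $V$ (edges), and a subset $D\subseteq E$ of directed edges, each $e\in D$ having an origin and a terminus, which are the two distinct endpoints of $e$. An undirected edge $\{a,b\}\in E\setminus D$ is written $[a,b]$; a directed edge with origin $a$ and terminus $b$ is written $[a,b\rangle$. The twisted right-angled Artin group (tRAAG) based on $\Gamma$ is $G_\Gamma=\langle V\mid ab=ba \text{ if }[a,b]\text{ is an undirected edge},\ aba=b\text{ if }[a,b\rangle\text{ is a directed edge}\rangle$. The underlying graph of $\Gamma$ is the simplicial graph $\overline{\Gamma}=(V,E)$ obtained by forgetting directions, and the underlying RAAG of $G_\Gamma$ is $G_{\overline\Gamma}=\langle V\mid ab=ba\text{ if }\{a,b\}\in E\rangle$. *)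

theory Defs
  imports "HOL-Algebra.Group"
begin

section \<open>Simplicial graphs and mixed graphs\<close>

text \<open>An undirected graph is a pair of a vertex set and a set of edges, an edge being the set of
  its endpoints.\<close>

type_synonym 'v ugraph = "'v set \<times> 'v set set"

definition ugraph_iso :: "'a ugraph \<Rightarrow> 'b ugraph \<Rightarrow> bool" where
  "ugraph_iso A B \<longleftrightarrow> (\<exists>f. bij_betw f (fst A) (fst B) \<and> (\<lambda>e. f ` e) ` snd A = snd B)"

text \<open>The fields \<open>origin\<close> and \<open>terminus\<close> are meaningful only on directed edges.\<close>

record 'v mixed_graph =
  mverts :: "'v set"
  medges :: "'v set set"
  mdirected :: "'v set set"
  origin :: "'v set \<Rightarrow> 'v"
  terminus :: "'v set \<Rightarrow> 'v"

definition finite_mixed_graph :: "'v mixed_graph \<Rightarrow> bool" where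
  "finite_mixed_graph \<Gamma> \<longleftrightarrow>
     finite (mverts \<Gamma>) \<and>
     (\<forall>e\<in>medges \<Gamma>. e \<subseteq> mverts \<Gamma> \<and> card e = 2) \<and>
     mdirected \<Gamma> \<subseteq> medges \<Gamma> \<and>
     (\<forall>e\<in>mdirected \<Gamma>. origin \<Gamma> e \<noteq> terminus \<Gamma> e \<and> e = {origin \<Gamma> e, terminus \<Gamma> e})"

definition underlying_graph :: "'v mixed_graph \<Rightarrow> 'v ugraph" where
  "underlying_graph \<Gamma> = (mverts \<Gamma>, medges \<Gamma>)"

section \<open>Group presentations\<close>

text \<open>The letter \<open>(x, True)\<close> stands for the generator \<open>x\<close> and \<open>(x, False)\<close> for its formal inverse.
  A relation \<open>l = r\<close> is the pair \<open>(l, r)\<close>.\<close>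

type_synonym 'v word = "('v \<times> bool) list"

definition words :: "'v set \<Rightarrow> 'v word set" where
  "words X = lists (X \<times> UNIV)"

inductive pres_eq :: "'v set \<Rightarrow> ('v word \<times> 'v word) set \<Rightarrow> 'v word \<Rightarrow> 'v word \<Rightarrow> bool"
  for X :: "'v set" and R :: "('v word \<times> 'v word) set" where
  refl: "w \<in> words X \<Longrightarrow> pres_eq X R w w"
| sym: "pres_eq X R u v \<Longrightarrow> pres_eq X R v u"
| trans: "pres_eq X R u v \<Longrightarrow> pres_eq X R v w \<Longrightarrow> pres_eq X R u w"
| cancel: "u \<in> words X \<Longrightarrow> v \<in> words X \<Longrightarrow> x \<in> X \<Longrightarrow>
    pres_eq X R (u @ [(x, b), (x, \<not> b)] @ v) (u @ v)"
| rel: "u \<in> words X \<Longrightarrow> v \<in> words X \<Longrightarrow> (l, r) \<in> R \<Longrightarrow> l \<in> words X \<Longrightarrow> r \<in> words X \<Longrightarrow>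
    pres_eq X R (u @ l @ v) (u @ r @ v)"

definition word_class :: "'v set \<Rightarrow> ('v word \<times> 'v word) set \<Rightarrow> 'v word \<Rightarrow> 'v word set" where
  "word_class X R w = {w'. pres_eq X R w w'}"

definition presented_group ::
    "'v set \<Rightarrow> ('v word \<times> 'v word) set \<Rightarrow> ('v word set) monoid" where
  "presented_group X R =
     \<lparr>carrier = word_class X R ` words X,
      mult = (\<lambda>A B. {w. \<exists>u\<in>A. \<exists>v\<in>B. pres_eq X R (u @ v) w}),
      one = word_class X R []\<rparr>"

definition pres_gen :: "'v set \<Rightarrow> ('v word \<times> 'v word) set \<Rightarrow> 'v \<Rightarrow> 'v word set" where
  "pres_gen X R x = word_class X R [(x, True)]"

subsection \<open>A presented group is a group with the expected universal property\<close>

lemma words_simps [simp]: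
  "[] \<in> words X"
  "p # w \<in> words X \<longleftrightarrow> fst p \<in> X \<and> w \<in> words X"
  "u @ v \<in> words X \<longleftrightarrow> u \<in> words X \<and> v \<in> words X"
  by (auto simp: words_def mem_Times_iff)

lemma pres_eq_words: "pres_eq X R u v \<Longrightarrow> u \<in> words X \<and> v \<in> words X"
  by (induction rule: pres_eq.induct) auto

lemma pres_eq_context:
  assumes "pres_eq X R u v" "p \<in> words X" "q \<in> words X"
  shows "pres_eq X R (p @ u @ q) (p @ v @ q)"
  using assms(1)
proof (induction rule: pres_eq.induct)
  case (cancel u v x b)
  then show ?case using pres_eq.cancel[of "p @ u" X "v @ q" x R b] assms by simp
next
  case (rel u v l r)
  then show ?case using pres_eq.rel[of "p @ u" X "v @ q" l r R] assms by simp
qed (use assms in \<open>auto intro: pres_eq.intros\<close>)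

lemma pres_eq_append:
  assumes "pres_eq X R u u'" "pres_eq X R v v'"
  shows "pres_eq X R (u @ v) (u' @ v')"
  using pres_eq_context[OF assms(1), of "[]" v] pres_eq_context[OF assms(2), of u' "[]"]
    pres_eq_words[OF assms(1)] pres_eq_words[OF assms(2)]
  by (auto intro: pres_eq.trans)

lemma word_class_eq_iff:
  assumes "u \<in> words X"
  shows "word_class X R u = word_class X R v \<longleftrightarrow> pres_eq X R u v"
  using assms unfolding word_class_def
  by (auto intro: pres_eq.intros)

lemma presented_mult:
  assumes "u \<in> words X" "v \<in> words X"
  shows "word_class X R u \<otimes>\<^bsub>presented_group X R\<^esub> word_class X R v = word_class X R (u @ v)"
  using assms unfolding presented_group_def word_class_def
  by (auto intro: pres_eq.trans pres_eq_append pres_eq.refl)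

definition inv_word :: "'v word \<Rightarrow> 'v word" where
  "inv_word w = rev (map (\<lambda>(x, b). (x, \<not> b)) w)"

lemma inv_word_words [simp]: "inv_word w \<in> words X \<longleftrightarrow> w \<in> words X"
  by (induction w) (auto simp: inv_word_def)

lemma inv_word_cancel: "w \<in> words X \<Longrightarrow> pres_eq X R (inv_word w @ w) []"
proof (induction w)
  case Nil
  then show ?case by (simp add: inv_word_def pres_eq.refl)
next
  case (Cons p w)
  obtain x b where p: "p = (x, b)" by fastforce
  have "pres_eq X R (inv_word w @ [(x, \<not> b), (x, \<not> \<not> b)] @ w) (inv_word w @ w)"
    by (rule pres_eq.cancel) (use Cons p in auto)
  with Cons p show ?case by (auto simp: inv_word_def intro: pres_eq.trans)
qed

lemma presented_carrier: "carrier (presented_group X R) = word_class X R ` words X"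
  and presented_one: "\<one>\<^bsub>presented_group X R\<^esub> = word_class X R []"
  by (simp_all add: presented_group_def)

theorem presented_group_group: "group (presented_group X R)"
proof (rule groupI)
  fix A assume "A \<in> carrier (presented_group X R)"
  then obtain w where w: "w \<in> words X" "A = word_class X R w"
    by (auto simp: presented_carrier)
  show "\<exists>B\<in>carrier (presented_group X R). B \<otimes>\<^bsub>presented_group X R\<^esub> A = \<one>\<^bsub>presented_group X R\<^esub>"
    using w inv_word_cancel[OF w(1), of R]
    by (intro bexI[of _ "word_class X R (inv_word w)"])
      (auto simp: presented_carrier presented_one presented_mult word_class_eq_iff)
qed (auto simp: presented_carrier presented_one presented_mult)

fun eval_word :: "('g, 'm) monoid_scheme \<Rightarrow> ('v \<Rightarrow> 'g) \<Rightarrow> 'v word \<Rightarrow> 'g" where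
  "eval_word H f [] = \<one>\<^bsub>H\<^esub>"
| "eval_word H f ((x, b) # w) = (if b then f x else inv\<^bsub>H\<^esub> f x) \<otimes>\<^bsub>H\<^esub> eval_word H f w"

theorem presented_group_universal:
  assumes H: "group H" and f: "f \<in> X \<rightarrow> carrier H"
    and R: "\<And>l r. (l, r) \<in> R \<Longrightarrow> eval_word H f l = eval_word H f r"
  shows "\<exists>h\<in>hom (presented_group X R) H. \<forall>x\<in>X. h (pres_gen X R x) = f x"
proof -
  interpret H: group H by fact
  have cl: "eval_word H f w \<in> carrier H" if "w \<in> words X" for w
    using that f by (induction w) (auto simp: Pi_iff)
  have app: "eval_word H f (u @ v) = eval_word H f u \<otimes>\<^bsub>H\<^esub> eval_word H f v"
    if "u \<in> words X" "v \<in> words X" for u v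
    using that f cl by (induction u) (auto simp: H.m_assoc Pi_iff)
  have canc: "eval_word H f [(x, b), (x, \<not> b)] = \<one>\<^bsub>H\<^esub>" if "x \<in> X" for x b
    using that f by (cases b) (auto simp: Pi_iff)
  have inv: "eval_word H f u = eval_word H f v" if "pres_eq X R u v" for u v
    using that
  proof (induction rule: pres_eq.induct)
    case (cancel u v x b)
    have "eval_word H f (u @ [(x, b), (x, \<not> b)] @ v)
        = eval_word H f u \<otimes>\<^bsub>H\<^esub> (eval_word H f [(x, b), (x, \<not> b)] \<otimes>\<^bsub>H\<^esub> eval_word H f v)"
      using cancel by (simp only: app words_simps fst_conv simp_thms)
    with cancel show ?case by (simp only: canc app cl H.l_one)
  next
    case (rel u v l r)
    then show ?case by (simp add: app R)
  qed auto
  define h where "h A = eval_word H f (SOME w. w \<in> A)" for A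
  have h: "h (word_class X R w) = eval_word H f w" if "w \<in> words X" for w
  proof -
    have "(SOME u. u \<in> word_class X R w) \<in> word_class X R w"
      by (rule someI[of _ w]) (simp add: word_class_def pres_eq.refl that)
    then show ?thesis using inv by (simp add: h_def word_class_def)
  qed
  show ?thesis
  proof (intro bexI[of _ h] ballI)
    show "h \<in> hom (presented_group X R) H"
      by (rule homI) (auto simp: presented_carrier presented_mult h cl app)
    show "h (pres_gen X R x) = f x" if "x \<in> X" for x
      using that f by (auto simp: pres_gen_def h Pi_iff)
  qed
qed

section \<open>Twisted and ordinary right-angled Artin groups\<close>

definition comm_rel :: "'v \<Rightarrow> 'v \<Rightarrow> 'v word \<times> 'v word" where
  "comm_rel a b = ([(a, True), (b, True)], [(b, True), (a, True)])"

definition klein_rel :: "'v \<Rightarrow> 'v \<Rightarrow> 'v word \<times> 'v word" where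
  "klein_rel a b = ([(a, True), (b, True), (a, True)], [(b, True)])"

definition traag_rels :: "'v mixed_graph \<Rightarrow> ('v word \<times> 'v word) set" where
  "traag_rels \<Gamma> =
     {comm_rel a b | a b. {a, b} \<in> medges \<Gamma> - mdirected \<Gamma>} \<union>
     {klein_rel (origin \<Gamma> e) (terminus \<Gamma> e) | e. e \<in> mdirected \<Gamma>}"

definition traag :: "'v mixed_graph \<Rightarrow> ('v word set) monoid" where
  "traag \<Gamma> = presented_group (mverts \<Gamma>) (traag_rels \<Gamma>)"

definition traag_gen :: "'v mixed_graph \<Rightarrow> 'v \<Rightarrow> 'v word set" where
  "traag_gen \<Gamma> = pres_gen (mverts \<Gamma>) (traag_rels \<Gamma>)"

definition raag_rels :: "'v ugraph \<Rightarrow> ('v word \<times> 'v word) set" where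
  "raag_rels \<Delta> = {comm_rel a b | a b. {a, b} \<in> snd \<Delta>}"

definition raag :: "'v ugraph \<Rightarrow> ('v word set) monoid" where
  "raag \<Delta> = presented_group (fst \<Delta>) (raag_rels \<Delta>)"

definition raag_gen :: "'v ugraph \<Rightarrow> 'v \<Rightarrow> 'v word set" where
  "raag_gen \<Delta> = pres_gen (fst \<Delta>) (raag_rels \<Delta>)"

section \<open>Cayley graphs\<close>

definition sym_gens :: "('g, 'm) monoid_scheme \<Rightarrow> ('v \<Rightarrow> 'g) \<Rightarrow> 'v set \<Rightarrow> 'g set" where
  "sym_gens G \<iota> X = \<iota> ` X \<union> (\<lambda>x. inv\<^bsub>G\<^esub> \<iota> x) ` X"

text \<open>Should \<open>S\<close> contain the identity, the edge \<open>{g}\<close> is a loop, and it is kept.\<close>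

definition cayley_graph :: "('g, 'm) monoid_scheme \<Rightarrow> 'g set \<Rightarrow> 'g ugraph" where
  "cayley_graph G S = (carrier G, {{g, g \<otimes>\<^bsub>G\<^esub> s} | g s. g \<in> carrier G \<and> s \<in> S})"

end

theory Submission
  imports Defs
begin

text \<open>
  In the twisted group a directed edge from \<open>a\<close> to \<open>b\<close> says that moving \<open>a\<^sup>\<plusminus>\<close> past \<open>b\<^sup>\<plusminus>\<close>
  inverts \<open>a\<close> and keeps \<open>b\<close>, whereas in the right-angled Artin group both letters keep their
  exponents. This discrepancy can be absorbed into the spelling of words: read a word from left to
  right and invert an occurrence of \<open>a\<close> whenever the number of preceding letters \<open>b\<^sup>\<plusminus>\<close>, over all
  directed edges from \<open>a\<close> to some \<open>b\<close>, is odd. Call this map \<open>twist\<close>.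

  Whether a letter is inverted depends only on the underlying vertices of the letters before it,
  which \<open>twist\<close> leaves alone. Hence \<open>twist\<close> is an involution, and it sends \<open>w @ [p]\<close> to
  \<open>twist w @ [q]\<close>, where \<open>q\<close> is \<open>p\<close> or its inverse. Moreover it carries every defining relation
  of either group, in any context, to a consequence of the relations of the other: the relation
  \<open>a b a = b\<close>, for instance, becomes \<open>a\<^sup>\<epsilon> b\<^sup>\<delta> a\<^sup>-\<^sup>\<epsilon> = b\<^sup>\<delta>\<close>. The letters to the right of the relation
  do not notice the replacement, because on its two sides each vertex occurs equally often modulo 2.

  So \<open>twist\<close> induces a bijection between the two groups. It maps the Cayley edge joining the classes
  of \<open>w\<close> and \<open>w @ [p]\<close> to the edge joining the classes of \<open>twist w\<close> and \<open>twist w @ [q]\<close>; since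
  every generating set in question is closed under inversion and edges carry no labels, this is a
  graph isomorphism. The bijection is not a homomorphism in general.
\<close>

section \<open>Twisting words\<close>

text \<open>The relation \<open>F x y\<close> means that passing the vertex \<open>x\<close> toggles the exponents of later
  occurrences of \<open>y\<close>. The accumulated toggles are carried in \<open>\<sigma>\<close>; making them an argument is what
  allows a word to be split at any place.\<close>

fun twist :: "('v \<Rightarrow> 'v \<Rightarrow> bool) \<Rightarrow> ('v \<Rightarrow> bool) \<Rightarrow> 'v word \<Rightarrow> 'v word" where
  "twist F \<sigma> [] = []"
| "twist F \<sigma> ((x, b) # w) = (x, b \<noteq> \<sigma> x) # twist F (\<lambda>y. \<sigma> y \<noteq> F x y) w"

fun toggles_after :: "('v \<Rightarrow> 'v \<Rightarrow> bool) \<Rightarrow> ('v \<Rightarrow> bool) \<Rightarrow> 'v word \<Rightarrow> ('v \<Rightarrow> bool)" where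
  "toggles_after F \<sigma> [] = \<sigma>"
| "toggles_after F \<sigma> ((x, b) # w) = toggles_after F (\<lambda>y. \<sigma> y \<noteq> F x y) w"

lemma twist_append:
  "twist F \<sigma> (u @ v) = twist F \<sigma> u @ twist F (toggles_after F \<sigma> u) v"
  by (induction F \<sigma> u rule: twist.induct) auto

lemma toggles_after_append:
  "toggles_after F \<sigma> (u @ v) = toggles_after F (toggles_after F \<sigma> u) v"
  by (induction F \<sigma> u rule: twist.induct) auto

lemma twist_twist [simp]: "twist F \<sigma> (twist F \<sigma> w) = w"
  by (induction F \<sigma> w rule: twist.induct) auto

lemma inj_twist: "inj (twist F \<sigma>)"
  by (metis injI twist_twist)

lemma twist_words [simp]: "twist F \<sigma> w \<in> words X \<longleftrightarrow> w \<in> words X"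
  by (induction F \<sigma> w rule: twist.induct) auto

lemma twist_image_words: "twist F \<sigma> ` words X = words X"
proof
  show "words X \<subseteq> twist F \<sigma> ` words X"
    by (metis image_eqI subsetI twist_twist twist_words)
qed auto

section \<open>Twists that respect presentations\<close>

definition twist_respects ::
    "('v \<Rightarrow> 'v \<Rightarrow> bool) \<Rightarrow> 'v set \<Rightarrow> ('v word \<times> 'v word) set \<Rightarrow> ('v word \<times> 'v word) set \<Rightarrow> bool" where
  "twist_respects F X R R' \<longleftrightarrow>
     (\<forall>l r \<sigma>. (l, r) \<in> R \<longrightarrow> l \<in> words X \<longrightarrow> r \<in> words X \<longrightarrow>
        toggles_after F \<sigma> l = toggles_after F \<sigma> r \<and> pres_eq X R' (twist F \<sigma> l) (twist F \<sigma> r))"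

text \<open>Equality of the toggles is proved along with equality of the twists: it is what makes the two
  sides of a rewriting step act alike on everything to their right. For a cancelled pair
  \<open>x\<^sup>\<plusminus> x\<^sup>\<mp>\<close>, irreflexivity of \<open>F\<close> keeps the exponents opposite, and the toggles caused by the two
  letters annihilate.\<close>

lemma pres_eq_twist:
  assumes "pres_eq X R u v" and F: "\<And>x. \<not> F x x" and R: "twist_respects F X R R'"
  shows "toggles_after F \<sigma> u = toggles_after F \<sigma> v \<and> pres_eq X R' (twist F \<sigma> u) (twist F \<sigma> v)"
  using assms(1)
proof (induction rule: pres_eq.induct)
  case (refl w)
  then show ?case by (simp add: pres_eq.refl)
next
  case (sym u v)
  then show ?case by (simp add: pres_eq.sym)
next
  case (trans u v w)
  then show ?case by (auto intro: pres_eq.trans)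
next
  case (cancel u v x b)
  let ?\<tau> = "toggles_after F \<sigma> u"
  have "pres_eq X R'
      (twist F \<sigma> u @ [(x, b \<noteq> ?\<tau> x), (x, \<not> (b \<noteq> ?\<tau> x))] @ twist F ?\<tau> v)
      (twist F \<sigma> u @ twist F ?\<tau> v)"
    using cancel by (intro pres_eq.cancel) auto
  moreover have "(\<lambda>y. (?\<tau> y \<noteq> F x y) \<noteq> F x y) = ?\<tau>" by auto
  ultimately show ?case
    using F by (simp add: twist_append toggles_after_append)
next
  case (rel u v l r)
  let ?\<tau> = "toggles_after F \<sigma> u"
  have "toggles_after F ?\<tau> l = toggles_after F ?\<tau> r"
    "pres_eq X R' (twist F ?\<tau> l) (twist F ?\<tau> r)"
    using R rel unfolding twist_respects_def by blast+
  then show ?case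
    using rel by (simp add: twist_append toggles_after_append pres_eq_context)
qed

lemma twist_image_word_class:
  assumes F: "\<And>x. \<not> F x x"
    and R: "twist_respects F X R R'" and R': "twist_respects F X R' R"
  shows "twist F \<sigma> ` word_class X R w = word_class X R' (twist F \<sigma> w)"
proof
  show "twist F \<sigma> ` word_class X R w \<subseteq> word_class X R' (twist F \<sigma> w)"
    using pres_eq_twist[OF _ F R] by (auto simp: word_class_def)
  show "word_class X R' (twist F \<sigma> w) \<subseteq> twist F \<sigma> ` word_class X R w"
  proof
    fix v assume "v \<in> word_class X R' (twist F \<sigma> w)"
    then have "twist F \<sigma> v \<in> word_class X R w"
      using pres_eq_twist[OF _ F R', of "twist F \<sigma> w" v \<sigma>] by (simp add: word_class_def)
    then show "v \<in> twist F \<sigma> ` word_class X R w"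
      by (metis image_eqI twist_twist)
  qed
qed

section \<open>Cayley graphs of presented groups\<close>

lemma inv_pres_gen:
  assumes "x \<in> X"
  shows "inv\<^bsub>presented_group X R\<^esub> pres_gen X R x = word_class X R [(x, False)]"
proof -
  interpret group "presented_group X R" by (rule presented_group_group)
  have "pres_eq X R [(x, False), (x, True)] []"
    using pres_eq.cancel[of "[]" X "[]" x R False] assms by simp
  then show ?thesis
    using assms
    by (intro inv_equality)
      (auto simp: pres_gen_def presented_carrier presented_one presented_mult word_class_eq_iff)
qed

lemma sym_gens_presented:
  "sym_gens (presented_group X R) (pres_gen X R) X = {word_class X R [(x, b)] | x b. x \<in> X}"
proof -
  have "sym_gens (presented_group X R) (pres_gen X R) X
      = (\<lambda>x. word_class X R [(x, True)]) ` X \<union> (\<lambda>x. word_class X R [(x, False)]) ` X"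
    unfolding sym_gens_def
    by (intro arg_cong2[of _ _ _ _ "(\<union>)"] image_cong) (simp_all add: inv_pres_gen[unfolded pres_gen_def] pres_gen_def)
  also have "\<dots> = {word_class X R [(x, b)] | x b. x \<in> X}"
    unfolding image_def by (simp add: set_eq_iff ex_bool_eq) blast
  finally show ?thesis .
qed

lemma cayley_graph_presented:
  "cayley_graph (presented_group X R) (sym_gens (presented_group X R) (pres_gen X R) X) =
    (word_class X R ` words X,
     {{word_class X R w, word_class X R (w @ [(x, b)])} | w x b. w \<in> words X \<and> x \<in> X})"
proof -
  have "(\<exists>g s. e = {g, g \<otimes>\<^bsub>presented_group X R\<^esub> s} \<and> g \<in> word_class X R ` words X \<and>
            (\<exists>x b. s = word_class X R [(x, b)] \<and> x \<in> X)) \<longleftrightarrow>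
        (\<exists>w x b. e = {word_class X R w, word_class X R (w @ [(x, b)])} \<and> w \<in> words X \<and> x \<in> X)"
    for e
  proof
    assume "\<exists>g s. e = {g, g \<otimes>\<^bsub>presented_group X R\<^esub> s} \<and> g \<in> word_class X R ` words X \<and>
            (\<exists>x b. s = word_class X R [(x, b)] \<and> x \<in> X)"
    then obtain w x b where "w \<in> words X" "x \<in> X"
      "e = {word_class X R w,
            word_class X R w \<otimes>\<^bsub>presented_group X R\<^esub> word_class X R [(x, b)]}"
      by blast
    then show "\<exists>w x b. e = {word_class X R w, word_class X R (w @ [(x, b)])} \<and> w \<in> words X \<and> x \<in> X"
      by (auto simp: presented_mult)
  next
    assume "\<exists>w x b. e = {word_class X R w, word_class X R (w @ [(x, b)])} \<and> w \<in> words X \<and> x \<in> X"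
    then obtain w x b where "w \<in> words X" "x \<in> X"
      "e = {word_class X R w, word_class X R (w @ [(x, b)])}"
      by blast
    then have "e = {word_class X R w,
            word_class X R w \<otimes>\<^bsub>presented_group X R\<^esub> word_class X R [(x, b)]}"
      by (simp add: presented_mult)
    with \<open>w \<in> words X\<close> \<open>x \<in> X\<close>
    show "\<exists>g s. e = {g, g \<otimes>\<^bsub>presented_group X R\<^esub> s} \<and> g \<in> word_class X R ` words X \<and>
            (\<exists>x b. s = word_class X R [(x, b)] \<and> x \<in> X)"
      by blast
  qed
  then show ?thesis
    by (simp add: cayley_graph_def sym_gens_presented presented_carrier)
qed

text \<open>The isomorphism maps a group element, being a set of words, to its image under \<open>twist\<close>. It
  respects edges because twisting \<open>w @ [(x, b)]\<close> twists \<open>w\<close> and at most changes \<open>b\<close>; as \<open>b\<close> runs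
  over both truth values, so does the changed exponent.\<close>

theorem cayley_graph_iso_of_twist:
  assumes F: "\<And>x. \<not> F x x"
    and R: "twist_respects F X R R'" and R': "twist_respects F X R' R"
  shows "ugraph_iso
    (cayley_graph (presented_group X R) (sym_gens (presented_group X R) (pres_gen X R) X))
    (cayley_graph (presented_group X R') (sym_gens (presented_group X R') (pres_gen X R') X))"
proof -
  define t where "t = twist F (\<lambda>_. False)"
  define edge where "edge Q w x b = {word_class X Q w, word_class X Q (w @ [(x, b)])}" for Q w x b
  have t_class: "t ` word_class X R w = word_class X R' (t w)" for w
    unfolding t_def by (rule twist_image_word_class[OF F R R'])
  have t_edge: "(`) t ` edge R w x b = edge R' (t w) x (b \<noteq> toggles_after F (\<lambda>_. False) w x)"
    for w x b
    by (simp add: edge_def t_class) (simp add: t_def twist_append)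
  have t_words: "t ` words X = words X"
    by (simp add: t_def twist_image_words)
  have inj: "inj ((`) t)"
    by (rule injI) (simp add: t_def inj_image_eq_iff[OF inj_twist])
  have verts: "(`) t ` word_class X R ` words X = word_class X R' ` words X"
  proof -
    have "(`) t ` word_class X R ` words X = word_class X R' ` t ` words X"
      by (simp add: image_image t_class)
    then show ?thesis by (simp add: t_words)
  qed
  have edges: "(\<lambda>e. (`) t ` e) ` {edge R w x b | w x b. w \<in> words X \<and> x \<in> X}
      = {edge R' w x b | w x b. w \<in> words X \<and> x \<in> X}" (is "?L = ?R")
  proof
    show "?L \<subseteq> ?R"
    proof
      fix e assume "e \<in> ?L"
      then obtain w x b where "w \<in> words X" "x \<in> X" "e = (`) t ` edge R w x b" by blast
      then show "e \<in> ?R" using t_edge t_words by blast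
    qed
    show "?R \<subseteq> ?L"
    proof
      fix e assume "e \<in> ?R"
      then obtain w x b where e: "w \<in> words X" "x \<in> X" "e = edge R' w x b" by blast
      then obtain v where v: "v \<in> words X" "w = t v" using t_words by blast
      have "e = (`) t ` edge R v x (b \<noteq> toggles_after F (\<lambda>_. False) v x)"
        unfolding t_edge e(3) v(2) by (rule arg_cong[of _ _ "edge R' (t v) x"]) auto
      with v e show "e \<in> ?L" by blast
    qed
  qed
  show ?thesis
    unfolding ugraph_iso_def cayley_graph_presented
    using inj verts edges
    by (intro exI[of _ "(`) t"])
      (auto simp: bij_betw_def edge_def intro: inj_on_subset)
qed

section \<open>Signed commutation\<close>

text \<open>Multiplying \<open>p q = q' p'\<close> on the left by the inverse of \<open>q'\<close> and on the right by the inverse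
  of \<open>q\<close> rotates it into a relation of the same shape. Four rotations return to the start, and,
  up to exchanging the two sides, they run through all exponents of the two vertices.\<close>

lemma pres_eq_rotate:
  assumes eq: "pres_eq X R [p, (y, s)] [(z, t), p']"
  shows "pres_eq X R [(z, \<not> t), p] [p', (y, \<not> s)]"
proof -
  have X: "fst p \<in> X" "y \<in> X" "z \<in> X" "fst p' \<in> X"
    using pres_eq_words[OF eq] by auto
  have "pres_eq X R [(z, \<not> t), p, (y, s), (y, \<not> s)] [(z, \<not> t), p]"
    using pres_eq.cancel[of "[(z, \<not> t), p]" X "[]" y R s] X by simp
  moreover have "pres_eq X R [(z, \<not> t), p, (y, s), (y, \<not> s)] [(z, \<not> t), (z, t), p', (y, \<not> s)]"
    using pres_eq_context[OF eq, of "[(z, \<not> t)]" "[(y, \<not> s)]"] X by simp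
  moreover have "pres_eq X R [(z, \<not> t), (z, t), p', (y, \<not> s)] [p', (y, \<not> s)]"
    using pres_eq.cancel[of "[]" X "[p', (y, \<not> s)]" z R "\<not> t"] X by simp
  ultimately show ?thesis
    by (meson pres_eq.sym pres_eq.trans)
qed

text \<open>The flag \<open>k\<close> distinguishes commutation from the Klein bottle relation, where \<open>a\<close> is
  inverted.\<close>

lemma pres_eq_swap_all_signs:
  assumes 1: "pres_eq X R [(a, True), (b, True)] [(b, True), (a, \<not> k)]"
  shows "pres_eq X R [(a, s), (b, t)] [(b, t), (a, s \<noteq> k)]"
proof -
  note 2 = pres_eq_rotate[OF 1]
  note 3 = pres_eq_rotate[OF 2]
  note 4 = pres_eq_rotate[OF 3]
  show ?thesis
    using 1 2 3 4 pres_eq.sym[OF 2] pres_eq.sym[OF 4] by (cases s; cases t; cases k) simp_all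
qed

lemma comm_swap:
  assumes "comm_rel a b \<in> R" "a \<in> X" "b \<in> X"
  shows "pres_eq X R [(a, s), (b, t)] [(b, t), (a, s)]"
proof -
  have "pres_eq X R [(a, True), (b, True)] [(b, True), (a, \<not> False)]"
    using pres_eq.rel[of "[]" X "[]" "[(a, True), (b, True)]" "[(b, True), (a, True)]" R] assms
    by (simp add: comm_rel_def)
  from pres_eq_swap_all_signs[OF this] show ?thesis by simp
qed

lemma klein_swap:
  assumes "klein_rel a b \<in> R" "a \<in> X" "b \<in> X"
  shows "pres_eq X R [(a, s), (b, t)] [(b, t), (a, \<not> s)]"
proof -
  have "pres_eq X R [(a, True), (b, True), (a, True), (a, False)] [(b, True), (a, False)]"
    using pres_eq.rel[of "[]" X "[(a, False)]" "[(a, True), (b, True), (a, True)]" "[(b, True)]" R]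
      assms by (simp add: klein_rel_def)
  moreover have
    "pres_eq X R [(a, True), (b, True), (a, True), (a, False)] [(a, True), (b, True)]"
    using pres_eq.cancel[of "[(a, True), (b, True)]" X "[]" a R True] assms by simp
  ultimately have "pres_eq X R [(a, True), (b, True)] [(b, True), (a, \<not> True)]"
    by (simp, meson pres_eq.sym pres_eq.trans)
  from pres_eq_swap_all_signs[OF this] show ?thesis by simp
qed

section \<open>The twist of a mixed graph\<close>

definition inverts :: "'v mixed_graph \<Rightarrow> 'v \<Rightarrow> 'v \<Rightarrow> bool" where
  "inverts \<Gamma> b a \<longleftrightarrow> {a, b} \<in> mdirected \<Gamma> \<and> origin \<Gamma> {a, b} = a \<and> terminus \<Gamma> {a, b} = b"

lemma not_inverts_self:
  assumes "finite_mixed_graph \<Gamma>"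
  shows "\<not> inverts \<Gamma> x x"
  using assms unfolding finite_mixed_graph_def inverts_def by metis

lemma inverts_asym:
  assumes "finite_mixed_graph \<Gamma>" "inverts \<Gamma> b a"
  shows "\<not> inverts \<Gamma> a b"
  using assms unfolding finite_mixed_graph_def inverts_def by (metis insert_commute)

lemma directed_edgeE:
  assumes "finite_mixed_graph \<Gamma>" "e \<in> mdirected \<Gamma>"
  obtains a b where "e = {a, b}" "origin \<Gamma> e = a" "terminus \<Gamma> e = b" "inverts \<Gamma> b a"
    "{a, b} \<in> medges \<Gamma>"
  using assms unfolding finite_mixed_graph_def inverts_def by (metis subsetD)

lemma edge_endpoints:
  assumes "finite_mixed_graph \<Gamma>" "{a, b} \<in> medges \<Gamma>"
  shows "a \<in> mverts \<Gamma>" "b \<in> mverts \<Gamma>"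
  using assms unfolding finite_mixed_graph_def by auto

lemma toggles_after_swap:
  "toggles_after F \<sigma> [(a, s), (b, t)] = toggles_after F \<sigma> [(b, t'), (a, s')]"
  by auto

lemma traag_swap:
  assumes \<Gamma>: "finite_mixed_graph \<Gamma>" and "inverts \<Gamma> b a"
  shows "pres_eq (mverts \<Gamma>) (traag_rels \<Gamma>) [(a, s), (b, t)] [(b, t), (a, \<not> s)]"
proof (rule klein_swap)
  show "klein_rel a b \<in> traag_rels \<Gamma>"
    using assms(2) unfolding inverts_def traag_rels_def by force
  have "{a, b} \<in> medges \<Gamma>"
    using assms unfolding finite_mixed_graph_def inverts_def by blast
  then show "a \<in> mverts \<Gamma>" "b \<in> mverts \<Gamma>" by (rule edge_endpoints[OF \<Gamma>])+
qed

lemma twist_respects_traag_raag: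
  assumes \<Gamma>: "finite_mixed_graph \<Gamma>"
  shows "twist_respects (inverts \<Gamma>) (mverts \<Gamma>) (traag_rels \<Gamma>) (raag_rels (underlying_graph \<Gamma>))"
  unfolding twist_respects_def
proof (intro allI impI)
  let ?R = "raag_rels (underlying_graph \<Gamma>)" and ?X = "mverts \<Gamma>"
  have swap: "pres_eq ?X ?R [(a, s), (b, t)] [(b, t), (a, s)]" if "{a, b} \<in> medges \<Gamma>" for a b s t
    using that edge_endpoints[OF \<Gamma> that]
    by (intro comm_swap) (auto simp: raag_rels_def underlying_graph_def)
  fix l r \<sigma>
  assume lr: "(l, r) \<in> traag_rels \<Gamma>"
  consider
      (undirected) a b where "(l, r) = comm_rel a b" "{a, b} \<in> medges \<Gamma> - mdirected \<Gamma>"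
    | (directed) a b where "(l, r) = klein_rel a b" "inverts \<Gamma> b a" "{a, b} \<in> medges \<Gamma>"
    using lr unfolding traag_rels_def by (auto elim: directed_edgeE[OF \<Gamma>])
  then show "toggles_after (inverts \<Gamma>) \<sigma> l = toggles_after (inverts \<Gamma>) \<sigma> r \<and>
      pres_eq ?X ?R (twist (inverts \<Gamma>) \<sigma> l) (twist (inverts \<Gamma>) \<sigma> r)"
  proof cases
    case undirected
    then have "\<not> inverts \<Gamma> a b" "\<not> inverts \<Gamma> b a"
      by (auto simp: inverts_def insert_commute)
    with undirected swap[of a b] show ?thesis
      by (auto simp: comm_rel_def)
  next
    case directed
    let ?s = "\<sigma> a" and ?t = "\<sigma> b"
    note X = edge_endpoints[OF \<Gamma> directed(3)]
    \<comment> \<open>The second occurrence of \<open>a\<close> has passed \<open>b\<close>, so its exponent has become opposite to that of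
      the first, and the two cancel after a commutation.\<close>
    have "pres_eq ?X ?R [(a, \<not> ?s), (b, \<not> ?t), (a, ?s)] [(b, \<not> ?t), (a, \<not> ?s), (a, ?s)]"
      using pres_eq_context[OF swap[OF directed(3)], of "[]" "[(a, ?s)]" "\<not> ?s" "\<not> ?t"] X by simp
    moreover have "pres_eq ?X ?R [(b, \<not> ?t), (a, \<not> ?s), (a, ?s)] [(b, \<not> ?t)]"
      using pres_eq.cancel[of "[(b, \<not> ?t)]" ?X "[]" a ?R "\<not> ?s"] X by simp
    ultimately have "pres_eq ?X ?R [(a, \<not> ?s), (b, \<not> ?t), (a, ?s)] [(b, \<not> ?t)]"
      by (rule pres_eq.trans)
    with directed not_inverts_self[OF \<Gamma>] inverts_asym[OF \<Gamma> directed(2)] show ?thesis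
      by (auto simp: klein_rel_def)
  qed
qed

lemma twist_respects_raag_traag:
  assumes \<Gamma>: "finite_mixed_graph \<Gamma>"
  shows "twist_respects (inverts \<Gamma>) (mverts \<Gamma>) (raag_rels (underlying_graph \<Gamma>)) (traag_rels \<Gamma>)"
  unfolding twist_respects_def
proof (intro allI impI)
  let ?R = "traag_rels \<Gamma>" and ?X = "mverts \<Gamma>"
  fix l r \<sigma>
  assume "(l, r) \<in> raag_rels (underlying_graph \<Gamma>)"
  then obtain a b where ab: "{a, b} \<in> medges \<Gamma>" and lr: "(l, r) = comm_rel a b"
    by (auto simp: raag_rels_def underlying_graph_def)
  consider
      (undirected) "{a, b} \<notin> mdirected \<Gamma>"
    | (forward) "inverts \<Gamma> b a"
    | (backward) "inverts \<Gamma> a b"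
    by (metis \<Gamma> directed_edgeE doubleton_eq_iff)
  then have "pres_eq ?X ?R (twist (inverts \<Gamma>) \<sigma> l) (twist (inverts \<Gamma>) \<sigma> r)"
  proof cases
    case undirected
    then have "\<not> inverts \<Gamma> a b" "\<not> inverts \<Gamma> b a"
      by (auto simp: inverts_def insert_commute)
    moreover have "pres_eq ?X ?R [(a, s), (b, t)] [(b, t), (a, s)]" for s t
      using undirected ab edge_endpoints[OF \<Gamma> ab]
      by (intro comm_swap) (auto simp: traag_rels_def)
    ultimately show ?thesis
      using lr by (simp add: comm_rel_def)
  next
    case forward
    with traag_swap[OF \<Gamma> forward, of "\<not> \<sigma> a" "\<not> \<sigma> b"] inverts_asym[OF \<Gamma> forward] lr
    show ?thesis by (simp add: comm_rel_def)
  next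
    case backward
    with pres_eq.sym[OF traag_swap[OF \<Gamma> backward, of "\<not> \<sigma> b" "\<not> \<sigma> a"]]
      inverts_asym[OF \<Gamma> backward] lr
    show ?thesis by (simp add: comm_rel_def)
  qed
  with lr toggles_after_swap[of "inverts \<Gamma>" \<sigma> a True b True True True]
  show "toggles_after (inverts \<Gamma>) \<sigma> l = toggles_after (inverts \<Gamma>) \<sigma> r \<and>
      pres_eq ?X ?R (twist (inverts \<Gamma>) \<sigma> l) (twist (inverts \<Gamma>) \<sigma> r)"
    by (simp add: comm_rel_def)
qed

section \<open>Cayley graphs of twisted right-angled Artin groups\<close>

theorem theorem5p9:
  fixes \<Gamma> :: "'v mixed_graph"
  assumes "finite_mixed_graph \<Gamma>"
  shows "ugraph_iso
    (cayley_graph (traag \<Gamma>)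
      (sym_gens (traag \<Gamma>) (traag_gen \<Gamma>) (mverts \<Gamma>)))
    (cayley_graph (raag (underlying_graph \<Gamma>))
      (sym_gens (raag (underlying_graph \<Gamma>)) (raag_gen (underlying_graph \<Gamma>)) (mverts \<Gamma>)))"
proof -
  have "fst (underlying_graph \<Gamma>) = mverts \<Gamma>"
    by (simp add: underlying_graph_def)
  with cayley_graph_iso_of_twist[OF not_inverts_self[OF assms]
      twist_respects_traag_raag[OF assms] twist_respects_raag_traag[OF assms]]
  show ?thesis
    by (simp add: traag_def traag_gen_def raag_def raag_gen_def)
qed

end
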